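(* Let $G\leq\operatorname{Aut}(T)$ be a branch group and let $W$ be a weakly maximal subgroup of $G$. Then at least one of the following holds: (1) all the subgroups $\operatorname{Rist}_W(v)$, for $v$ a vertex of $T$, are infinite; (2) there exists a level $n$ such that for every $v$ in $\mathcal L_n$, the section $\pi_v\bigl(\operatorname{Stab}_W(v)\bigr)$ has finite index in $\pi_v\bigl(\operatorname{Stab}_G(v)\bigr)$.
   Context: $T$ is a rooted tree; all rooted trees are infinite and spherically regular (the number of children of a vertex depends only on its level), and every vertex has at least two children. $\operatorname{Aut}(T)$ is the group of graph automorphisms fixing the root; $\mathcal L_n$ is the set of vertices of level $n$; $T_v$ is the subtree of descendants of $v$. For $H\le\operatorname{Aut}(T)$, $\operatorname{Stab}_H(v)$ is the stabilizer of the vertex $v$, $\operatorname{Rist}_H(v)$ is the subgroup of elements of $H$ acting trivially outside $T_v$, and $\operatorname{Rist}_H(\mathcal L_n)=\prod_{v\in\mathcal L_n}\operatorname{Rist}_H(v)$. $G$ is branch if it acts transitively on every $\mathcal L_n$ and $\operatorname{Rist}_G(\mathcal L_n)$ has finite index in $G$ for every $n$. $\pi_v\colon\operatorname{Stab}_{\operatorname{Aut}(T)}(v)\to\operatorname{Aut}(T_v)$ is the restriction homomorphism. A subgroup is weakly maximal if it is maximal among the subgroups of infinite index of $G$. *)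

theory Defs
  imports "HOL-Algebra.Bij" "HOL-Algebra.Coset" "HOL-Algebra.Generated_Groups"
    "HOL-Library.Equipollence"
begin

section \<open>Rooted trees\<close>

record 'v rooted_graph =
  verts :: "'v set"
  edges :: "'v set set"
  root :: 'v

definition simple_path :: "'v rooted_graph \<Rightarrow> 'v \<Rightarrow> 'v list \<Rightarrow> 'v \<Rightarrow> bool" where
  "simple_path T u p v \<longleftrightarrow>
     p \<noteq> [] \<and> hd p = u \<and> last p = v \<and> distinct p \<and> set p \<subseteq> verts T \<and>
     successively (\<lambda>x y. {x, y} \<in> edges T) p"

locale rooted_tree =
  fixes T :: "'v rooted_graph"
  assumes edgesD: "e \<in> edges T \<Longrightarrow> \<exists>u\<in>verts T. \<exists>v\<in>verts T. u \<noteq> v \<and> e = {u, v}"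
    and root_in_verts: "root T \<in> verts T"
    and unique_path: "\<lbrakk>u \<in> verts T; v \<in> verts T\<rbrakk> \<Longrightarrow> \<exists>!p. simple_path T u p v"

definition root_path :: "'v rooted_graph \<Rightarrow> 'v \<Rightarrow> 'v list" where
  "root_path T v = (THE p. simple_path T (root T) p v)"

definition depth :: "'v rooted_graph \<Rightarrow> 'v \<Rightarrow> nat" where
  "depth T v = length (root_path T v) - 1"

definition level :: "'v rooted_graph \<Rightarrow> nat \<Rightarrow> 'v set" where
  "level T n = {v \<in> verts T. depth T v = n}"

definition descendants :: "'v rooted_graph \<Rightarrow> 'v \<Rightarrow> 'v set" where
  "descendants T v = {u \<in> verts T. v \<in> set (root_path T u)}"
  \<comment> \<open>\<^term>\<open>v\<close> counts as a descendant of itself.\<close>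

definition children :: "'v rooted_graph \<Rightarrow> 'v \<Rightarrow> 'v set" where
  "children T v = {u \<in> descendants T v. {v, u} \<in> edges T}"

definition subtree :: "'v rooted_graph \<Rightarrow> 'v \<Rightarrow> 'v rooted_graph" where
  "subtree T v =
     \<lparr>verts = descendants T v, edges = {e \<in> edges T. e \<subseteq> descendants T v}, root = v\<rparr>"

text \<open>
  The number of children is compared as a cardinal, so local finiteness is not assumed; it
  follows once a branch group acts on the tree. Infiniteness of the tree follows from
  \<open>two_children\<close>.
\<close>

locale spherically_regular_tree = rooted_tree +
  assumes regular: "\<lbrakk>u \<in> verts T; v \<in> verts T; depth T u = depth T v\<rbrakk>
      \<Longrightarrow> children T u \<approx> children T v"
    and two_children: "v \<in> verts T \<Longrightarrow> \<exists>x\<in>children T v. \<exists>y\<in>children T v. x \<noteq> y"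


section \<open>Groups of automorphisms\<close>

text \<open>
  Following \<^const>\<open>Bij\<close>, automorphisms are extensional functions: they are \<^term>\<open>undefined\<close>
  off the vertex set, so that equality in the group is equality on the vertices.
\<close>

definition Aut :: "'v rooted_graph \<Rightarrow> ('v \<Rightarrow> 'v) monoid" where
  "Aut T = (BijGroup (verts T))
     \<lparr>carrier := {g \<in> Bij (verts T).
        (\<forall>u\<in>verts T. \<forall>v\<in>verts T. {g u, g v} \<in> edges T \<longleftrightarrow> {u, v} \<in> edges T) \<and>
        g (root T) = root T}\<rparr>"

definition Stab :: "('v \<Rightarrow> 'v) set \<Rightarrow> 'v \<Rightarrow> ('v \<Rightarrow> 'v) set" where
  "Stab H v = {h \<in> H. h v = v}"

definition Rist :: "'v rooted_graph \<Rightarrow> ('v \<Rightarrow> 'v) set \<Rightarrow> 'v \<Rightarrow> ('v \<Rightarrow> 'v) set" where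
  "Rist T H v = {h \<in> H. \<forall>u \<in> verts T - descendants T v. h u = u}"

text \<open>
  The rigid stabilizers of distinct vertices of one level commute and meet trivially, so their
  product inside the ambient group is the subgroup they generate.
\<close>

definition Rist_level :: "'v rooted_graph \<Rightarrow> ('v \<Rightarrow> 'v) set \<Rightarrow> nat \<Rightarrow> ('v \<Rightarrow> 'v) set" where
  "Rist_level T H n = generate (Aut T) (\<Union>v\<in>level T n. Rist T H v)"

text \<open>The restriction homomorphism from the stabilizer of \<open>v\<close> in \<open>Aut T\<close> to \<open>Aut (subtree T v)\<close>.\<close>

definition restr_hom :: "'v rooted_graph \<Rightarrow> 'v \<Rightarrow> ('v \<Rightarrow> 'v) \<Rightarrow> ('v \<Rightarrow> 'v)" where
  "restr_hom T v g = restrict g (descendants T v)"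

definition has_finite_index :: "'a set \<Rightarrow> ('a, 'b) monoid_scheme \<Rightarrow> bool" where
  "has_finite_index K G \<longleftrightarrow> finite (rcosets\<^bsub>G\<^esub> K)"

definition weakly_maximal :: "'a set \<Rightarrow> ('a, 'b) monoid_scheme \<Rightarrow> bool" where
  "weakly_maximal W G \<longleftrightarrow>
     subgroup W G \<and> \<not> has_finite_index W G \<and>
     (\<forall>H. subgroup H G \<and> \<not> has_finite_index H G \<and> W \<subseteq> H \<longrightarrow> H = W)"

definition branch :: "'v rooted_graph \<Rightarrow> ('v \<Rightarrow> 'v) set \<Rightarrow> bool" where
  "branch T G \<longleftrightarrow>
     subgroup G (Aut T) \<and>
     (\<forall>n. \<forall>u\<in>level T n. \<forall>v\<in>level T n. \<exists>g\<in>G. g u = v) \<and>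
     (\<forall>n. has_finite_index (Rist_level T G n) ((Aut T)\<lparr>carrier := G\<rparr>))"

end

theory Submission
  imports Defs
begin

text \<open>
  Suppose some \<open>Rist_W(v)\<close> is finite and every level contains a vertex \<open>u\<close> at which the section of
  \<open>W\<close> has infinite index. Enlarging \<open>W\<close> by all elements of \<open>G\<close> that look like elements of \<open>W\<close> below
  the \<open>W\<close>-orbit of \<open>u\<close> does not change the section at \<open>u\<close>, so weak maximality puts them all in \<open>W\<close>.
  In particular \<open>W\<close> contains \<open>Rist_G(x)\<close> for \<open>x\<close> of the same level outside the orbit, and the
  elements of \<open>Rist_G(x)\<close> whose section lies in that of \<open>W\<close> for \<open>x\<close> in the orbit. Since \<open>Rist_G(x)\<close>
  is infinite, all descendants of \<open>v\<close> of that level lie in the orbit; since its section has finite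
  index in that of \<open>G\<close>, the section of \<open>W\<close> at each of them is finite. Thus the section of \<open>W\<close> at \<open>v\<close>
  is finite and yet transitive on every level below \<open>v\<close>, although these levels are unboundedly large.
\<close>

section \<open>Descendants in rooted trees\<close>

lemma descendants_subset: "descendants T v \<subseteq> verts T"
  by (auto simp: descendants_def)

lemma descendants_verts: "u \<in> descendants T v \<Longrightarrow> u \<in> verts T"
  by (simp add: descendants_def)

context rooted_tree
begin

lemma simple_path_root_path: "v \<in> verts T \<Longrightarrow> simple_path T (root T) (root_path T v) v"
  unfolding root_path_def by (rule theI'[OF unique_path[OF root_in_verts]])

lemma root_path_eqI: "simple_path T (root T) p v \<Longrightarrow> root_path T v = p"
proof -
  assume p: "simple_path T (root T) p v"
  then have "v \<in> verts T" by (auto simp: simple_path_def)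
  with unique_path[OF root_in_verts] p simple_path_root_path show ?thesis by blast
qed

text \<open>An initial segment of a simple path is simple, so by uniqueness it is the root path of
  its last vertex.\<close>

lemma root_path_prefix:
  assumes "u \<in> verts T" "root_path T u = xs @ x # ys"
  shows "x \<in> verts T" "root_path T x = xs @ [x]" "depth T x = length xs"
proof -
  have "simple_path T (root T) (xs @ x # ys) u"
    using simple_path_root_path[OF assms(1)] assms(2) by simp
  then have sp: "simple_path T (root T) (xs @ [x]) x"
    by (auto simp: simple_path_def successively_append_iff successively_Cons hd_append)
  then show "x \<in> verts T" by (auto simp: simple_path_def)
  show eq: "root_path T x = xs @ [x]" by (rule root_path_eqI[OF sp])
  show "depth T x = length xs" by (simp add: depth_def eq)
qed

lemma self_descendant: "v \<in> verts T \<Longrightarrow> v \<in> descendants T v"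
  using simple_path_root_path[of v] by (auto simp: descendants_def simple_path_def dest: last_in_set)

lemma descendants_trans:
  assumes "x \<in> descendants T v" "y \<in> descendants T x"
  shows "y \<in> descendants T v"
proof -
  obtain xs ys where "root_path T y = xs @ x # ys"
    using assms(2) by (auto simp: descendants_def dest: split_list)
  with assms root_path_prefix(2)[of y xs x ys] show ?thesis
    by (auto simp: descendants_def)
qed

lemma depth_descendant_le:
  assumes "u \<in> descendants T v"
  shows "depth T v \<le> depth T u"
proof -
  obtain xs ys where xs: "root_path T u = xs @ v # ys"
    using assms by (auto simp: descendants_def dest: split_list)
  with assms root_path_prefix(3)[of u xs v ys] show ?thesis
    by (simp add: descendants_def depth_def[of T u])
qed

text \<open>Each ancestor \<open>z\<close> of \<open>u\<close> stands at position
  \<open>depth T z\<close> in the root path of \<open>u\<close>, so ancestors of equal depth are the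
  same entry.\<close>

lemma descendant_unique:
  assumes "u \<in> descendants T x" "u \<in> descendants T y" "depth T x = depth T y"
  shows "x = y"
proof -
  have "\<exists>i < length (root_path T u). root_path T u ! i = z \<and> i = depth T z"
    if z: "u \<in> descendants T z" for z
  proof -
    obtain xs ys where "root_path T u = xs @ z # ys"
      using z by (auto simp: descendants_def dest: split_list)
    with z root_path_prefix(3)[of u xs z ys] show ?thesis
      by (auto simp: descendants_def)
  qed
  from this[OF assms(1)] this[OF assms(2)] assms(3) show ?thesis by auto
qed

lemma descendant_same_depth:
  assumes "u \<in> descendants T v" "depth T u = depth T v"
  shows "u = v"
  using descendant_unique[OF self_descendant assms(1)] assms descendants_subset by fastforce

lemma depth_child:
  assumes v: "v \<in> verts T" and c: "u \<in> children T v"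
  shows "depth T u = Suc (depth T v)"
proof -
  have u: "u \<in> verts T" "u \<in> descendants T v" and e: "{v, u} \<in> edges T"
    using c by (auto simp: children_def descendants_def)
  have "u \<noteq> v" using edgesD[OF e] by auto
  have sp: "simple_path T (root T) (root_path T v) v" by (rule simple_path_root_path[OF v])
  \<comment> \<open>Otherwise \<open>u\<close> and \<open>v\<close> would descend from each other,
    hence have equal depth and coincide.\<close>
  have "u \<notin> set (root_path T v)"
  proof
    assume "u \<in> set (root_path T v)"
    then have "v \<in> descendants T u" using v by (simp add: descendants_def)
    with u \<open>u \<noteq> v\<close> show False
      using depth_descendant_le descendant_same_depth by (metis le_antisym)
  qed
  with sp u e have "simple_path T (root T) (root_path T v @ [u]) u"
    by (auto simp: simple_path_def successively_append_iff)
  then have "root_path T u = root_path T v @ [u]" by (rule root_path_eqI)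
  then show ?thesis using sp by (auto simp: depth_def simple_path_def Suc_diff_le)
qed

end

text \<open>A linear bound suffices to make the levels below \<open>v\<close> unboundedly large. In
  the induction step, one child of each vertex of \<open>S\<close> and a second child of one of them
  give one vertex more.\<close>

lemma (in spherically_regular_tree) many_descendants:
  assumes "v \<in> verts T"
  shows "\<exists>S. S \<subseteq> descendants T v \<inter> level T (depth T v + k) \<and> finite S \<and> card S = Suc k"
proof (induction k)
  case 0
  show ?case
    by (rule exI[of _ "{v}"]) (use assms self_descendant in \<open>auto simp: level_def\<close>)
next
  case (Suc k)
  then obtain S where S: "S \<subseteq> descendants T v \<inter> level T (depth T v + k)" "finite S" "card S = Suc k"
    by blast
  have "\<forall>s\<in>S. \<exists>x y. x \<in> children T s \<and> y \<in> children T s \<and> x \<noteq> y"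
    using S(1) two_children by (fastforce simp: level_def)
  then obtain c d where cd: "\<And>s. s \<in> S \<Longrightarrow> c s \<in> children T s \<and> d s \<in> children T s \<and> c s \<noteq> d s"
    by metis
  have good: "x \<in> descendants T v \<inter> level T (depth T v + Suc k)"
    if "s \<in> S" "x \<in> children T s" for s x
    using that S(1) descendants_trans[of s v x] depth_child[of s x]
    by (auto simp: children_def level_def descendants_def)
  have depth_S: "depth T s = depth T v + k" if "s \<in> S" for s
    using that S(1) by (auto simp: level_def)
  have parent: "s = t" if "s \<in> S" "t \<in> S" "x \<in> children T s" "x \<in> children T t" for s t x
  proof (rule descendant_unique)
    show "x \<in> descendants T s" "x \<in> descendants T t" using that by (auto simp: children_def)
    show "depth T s = depth T t" using that depth_S by simp
  qed
  have inj: "inj_on c S" using parent cd by (metis inj_onI)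
  obtain s where s: "s \<in> S" using S(3) by (metis card_eq_0_iff equals0I nat.distinct(1))
  \<comment> \<open>The child \<open>d s\<close> differs from \<open>c s\<close> by choice, and by
    \<open>parent\<close> it is no child of another vertex of \<open>S\<close>.\<close>
  have "d s \<notin> c ` S" using parent[OF s] cd s by force
  then have "card (insert (d s) (c ` S)) = Suc (Suc k)"
    using S inj by (simp add: card_image)
  moreover have "insert (d s) (c ` S) \<subseteq> descendants T v \<inter> level T (depth T v + Suc k)"
    using good cd s by blast
  ultimately show ?case using S(2) by blast
qed

section \<open>The automorphism group\<close>

definition tree_auts :: "'v rooted_graph \<Rightarrow> ('v \<Rightarrow> 'v) set" where
  "tree_auts T = {g \<in> Bij (verts T).
        (\<forall>u\<in>verts T. \<forall>v\<in>verts T. {g u, g v} \<in> edges T \<longleftrightarrow> {u, v} \<in> edges T) \<and>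
        g (root T) = root T}"

lemma Aut_eq: "Aut T = (BijGroup (verts T))\<lparr>carrier := tree_auts T\<rparr>"
  by (simp add: Aut_def tree_auts_def)

lemma carrier_Aut: "carrier (Aut T) = tree_auts T"
  by (simp add: Aut_eq)

lemma tree_auts_Bij: "tree_auts T \<subseteq> Bij (verts T)"
  by (auto simp: tree_auts_def)

lemma tree_auts_verts [simp]: "g \<in> tree_auts T \<Longrightarrow> x \<in> verts T \<Longrightarrow> g x \<in> verts T"
  using Bij_imp_funcset[of g "verts T"] tree_auts_Bij[of T] by (blast dest: subsetD funcset_mem)

lemma tree_auts_inj:
  assumes "g \<in> tree_auts T" "x \<in> verts T" "y \<in> verts T"
  shows "g x = g y \<longleftrightarrow> x = y"
proof -
  have "g \<in> Bij (verts T)" using assms(1) tree_auts_Bij by blast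
  then have "inj_on g (verts T)" by (simp add: Bij_def bij_betw_def)
  then show ?thesis using assms(2,3) by (rule inj_on_eq_iff)
qed

lemma Aut_mult: "\<lbrakk>g \<in> tree_auts T; h \<in> tree_auts T\<rbrakk> \<Longrightarrow> g \<otimes>\<^bsub>Aut T\<^esub> h = compose (verts T) g h"
  using tree_auts_Bij[of T] by (auto simp: Aut_eq BijGroup_def)

lemma Aut_mult_apply:
  "\<lbrakk>g \<in> tree_auts T; h \<in> tree_auts T; x \<in> verts T\<rbrakk> \<Longrightarrow> (g \<otimes>\<^bsub>Aut T\<^esub> h) x = g (h x)"
  by (simp add: Aut_mult compose_def)

lemma Aut_one_apply: "x \<in> verts T \<Longrightarrow> \<one>\<^bsub>Aut T\<^esub> x = x"
  by (simp add: Aut_eq BijGroup_def)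

context rooted_tree
begin

lemma subgroup_tree_auts: "subgroup (tree_auts T) (BijGroup (verts T))"
proof (rule group.subgroupI[OF group_BijGroup])
  show "tree_auts T \<subseteq> carrier (BijGroup (verts T))"
    using tree_auts_Bij by (simp add: BijGroup_def)
  have "(\<lambda>x\<in>verts T. x) \<in> tree_auts T"
    using root_in_verts by (simp add: tree_auts_def id_Bij)
  then show "tree_auts T \<noteq> {}" by blast
next
  fix g assume g: "g \<in> tree_auts T"
  let ?f = "restrict (inv_into (verts T) g) (verts T)"
  have gB: "g \<in> Bij (verts T)" using g tree_auts_Bij by blast
  have fB: "?f \<in> Bij (verts T)" by (rule restrict_inv_into_Bij[OF gB])
  have gf: "g (?f x) = x" and fv: "?f x \<in> verts T" if "x \<in> verts T" for x
    using that gB fB by (auto simp: Bij_def bij_betw_def f_inv_into_f inv_into_into)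
  have "{?f u, ?f v} \<in> edges T \<longleftrightarrow> {u, v} \<in> edges T" if "u \<in> verts T" "v \<in> verts T" for u v
  proof -
    have "{g (?f u), g (?f v)} \<in> edges T \<longleftrightarrow> {?f u, ?f v} \<in> edges T"
      using g fv that unfolding tree_auts_def by blast
    then show ?thesis using that gf by simp
  qed
  moreover have "?f (root T) = root T"
    using tree_auts_inj[OF g, of "?f (root T)" "root T"] gf fv root_in_verts g
    by (simp add: tree_auts_def)
  ultimately have "?f \<in> tree_auts T" using fB by (simp add: tree_auts_def)
  then show "inv\<^bsub>BijGroup (verts T)\<^esub> g \<in> tree_auts T" using gB by (simp add: inv_BijGroup)
next
  fix g h assume gh: "g \<in> tree_auts T" "h \<in> tree_auts T"
  then have "g \<in> Bij (verts T)" "h \<in> Bij (verts T)" using tree_auts_Bij by blast+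
  moreover have "compose (verts T) g h \<in> tree_auts T"
    unfolding tree_auts_def
  proof (intro CollectI conjI ballI)
    show "compose (verts T) g h \<in> Bij (verts T)" using calculation by (rule compose_Bij)
    show "compose (verts T) g h (root T) = root T"
      using gh root_in_verts by (simp add: compose_def tree_auts_def)
    fix u v assume uv: "u \<in> verts T" "v \<in> verts T"
    then have "{g (h u), g (h v)} \<in> edges T \<longleftrightarrow> {h u, h v} \<in> edges T"
      using gh tree_auts_verts[OF gh(2)] unfolding tree_auts_def by blast
    then show "{compose (verts T) g h u, compose (verts T) g h v} \<in> edges T \<longleftrightarrow> {u, v} \<in> edges T"
      using gh(2) uv by (simp add: compose_def tree_auts_def)
  qed
  ultimately show "g \<otimes>\<^bsub>BijGroup (verts T)\<^esub> h \<in> tree_auts T" by (simp add: BijGroup_def)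
qed

lemma group_Aut: "group (Aut T)"
  unfolding Aut_eq by (rule subgroup.subgroup_is_group[OF subgroup_tree_auts group_BijGroup])

interpretation A: group "Aut T" by (rule group_Aut)

lemma Aut_inv_closed [simp]: "g \<in> tree_auts T \<Longrightarrow> inv\<^bsub>Aut T\<^esub> g \<in> tree_auts T"
  using A.inv_closed[of g] unfolding carrier_Aut .

lemma Aut_mult_closed [simp]:
  "g \<in> tree_auts T \<Longrightarrow> h \<in> tree_auts T \<Longrightarrow> g \<otimes>\<^bsub>Aut T\<^esub> h \<in> tree_auts T"
  using A.m_closed[of g h] unfolding carrier_Aut .

lemma Aut_inv_apply:
  assumes "g \<in> tree_auts T" "x \<in> verts T"
  shows "(inv\<^bsub>Aut T\<^esub> g) (g x) = x" "g ((inv\<^bsub>Aut T\<^esub> g) x) = x"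
proof -
  have gi: "inv\<^bsub>Aut T\<^esub> g \<in> tree_auts T" using assms(1) by (rule Aut_inv_closed)
  have gc: "g \<in> carrier (Aut T)" using assms(1) by (simp add: carrier_Aut)
  show "(inv\<^bsub>Aut T\<^esub> g) (g x) = x"
    using Aut_mult_apply[OF gi assms] A.l_inv[OF gc] Aut_one_apply[OF assms(2)] by simp
  show "g ((inv\<^bsub>Aut T\<^esub> g) x) = x"
    using Aut_mult_apply[OF assms(1) gi assms(2)] A.r_inv[OF gc] Aut_one_apply[OF assms(2)] by simp
qed

lemma Aut_inv_fix:
  assumes "g \<in> tree_auts T" "x \<in> verts T"
  shows "(inv\<^bsub>Aut T\<^esub> g) x = x \<longleftrightarrow> g x = x"
  using Aut_inv_apply[OF assms] by metis

text \<open>An automorphism carries a simple path from the root to a simple path from the root, and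
  paths are unique. Preservation of depth, levels and descendants follows from this.\<close>

lemma root_path_image:
  assumes g: "g \<in> tree_auts T" and v: "v \<in> verts T"
  shows "root_path T (g v) = map g (root_path T v)"
proof (rule root_path_eqI)
  have sp: "simple_path T (root T) (root_path T v) v" by (rule simple_path_root_path[OF v])
  have "inj_on g (set (root_path T v))"
    using sp tree_auts_inj[OF g] unfolding simple_path_def inj_on_def by blast
  moreover have "successively (\<lambda>x y. {g x, g y} \<in> edges T) (root_path T v)"
  proof (rule successively_mono)
    show "successively (\<lambda>x y. {x, y} \<in> edges T) (root_path T v)"
      using sp by (simp add: simple_path_def)
    fix x y assume "x \<in> set (root_path T v)" "y \<in> set (root_path T v)" "{x, y} \<in> edges T"
    then show "{g x, g y} \<in> edges T"
      using sp g unfolding simple_path_def tree_auts_def by blast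
  qed
  moreover have "g (root T) = root T" using g by (simp add: tree_auts_def)
  moreover have "set (map g (root_path T v)) \<subseteq> verts T"
    using sp tree_auts_verts[OF g] unfolding simple_path_def set_map by blast
  ultimately show "simple_path T (root T) (map g (root_path T v)) (g v)"
    using sp unfolding simple_path_def
    by (simp add: hd_map last_map distinct_map successively_map)
qed

lemma depth_image: "g \<in> tree_auts T \<Longrightarrow> v \<in> verts T \<Longrightarrow> depth T (g v) = depth T v"
  by (simp add: depth_def root_path_image)

lemma level_image: "g \<in> tree_auts T \<Longrightarrow> v \<in> level T n \<Longrightarrow> g v \<in> level T n"
  by (simp add: level_def depth_image)

lemma descendants_image:
  assumes g: "g \<in> tree_auts T" and v: "v \<in> verts T" and u: "u \<in> verts T"
  shows "g u \<in> descendants T (g v) \<longleftrightarrow> u \<in> descendants T v"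
proof -
  have "set (root_path T u) \<subseteq> verts T"
    using simple_path_root_path[OF u] by (simp add: simple_path_def)
  then have "g v \<in> g ` set (root_path T u) \<longleftrightarrow> v \<in> set (root_path T u)"
    using tree_auts_inj[OF g v] by blast
  then show ?thesis using g u v by (simp add: descendants_def root_path_image)
qed

lemma descendants_fixed:
  "\<lbrakk>g \<in> tree_auts T; v \<in> verts T; g v = v; u \<in> descendants T v\<rbrakk> \<Longrightarrow> g u \<in> descendants T v"
  using descendants_image[of g v u] by (auto simp: descendants_def)

section \<open>Restriction to the subtree below a fixed vertex\<close>

lemma restr_hom_eq_iff:
  "restr_hom T v g = restr_hom T v h \<longleftrightarrow> (\<forall>x\<in>descendants T v. g x = h x)"
  by (auto simp: restr_hom_def restrict_def fun_eq_iff)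

text \<open>The inverse of \<open>g\<close> fixes \<open>v\<close> too, so \<open>g\<close> maps the
  descendants of \<open>v\<close> onto themselves. Since the product of
  \<open>Aut (subtree T v)\<close> is composition only for bijections of its vertex set, this is
  what lets products of sections be computed.\<close>

lemma restr_hom_Bij:
  assumes "g \<in> tree_auts T" "v \<in> verts T" "g v = v"
  shows "restr_hom T v g \<in> Bij (descendants T v)"
proof -
  let ?D = "descendants T v"
  have sub: "?D \<subseteq> verts T" by (rule descendants_subset)
  have inj: "inj_on g ?D"
    using tree_auts_inj[OF assms(1)] sub by (meson inj_onI subsetD)
  have "x \<in> g ` ?D" if "x \<in> ?D" for x
  proof
    show "x = g ((inv\<^bsub>Aut T\<^esub> g) x)" using Aut_inv_apply(2)[OF assms(1)] that sub by auto
    show "(inv\<^bsub>Aut T\<^esub> g) x \<in> ?D"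
      using descendants_fixed[of "inv\<^bsub>Aut T\<^esub> g" v x] Aut_inv_fix assms that by simp
  qed
  then have "g ` ?D = ?D" using descendants_fixed[OF assms] by blast
  with inj have "bij_betw g ?D ?D" by (simp add: bij_betw_def)
  then have "bij_betw (restrict g ?D) ?D ?D" by simp
  then show ?thesis by (simp add: restr_hom_def Bij_def)
qed

lemma restr_hom_mult:
  assumes "g \<in> tree_auts T" "h \<in> tree_auts T" "v \<in> verts T" "g v = v" "h v = v"
  shows "restr_hom T v g \<otimes>\<^bsub>Aut (subtree T v)\<^esub> restr_hom T v h
       = restr_hom T v (g \<otimes>\<^bsub>Aut T\<^esub> h)"
proof -
  have "restr_hom T v g \<otimes>\<^bsub>Aut (subtree T v)\<^esub> restr_hom T v h
      = compose (descendants T v) (restr_hom T v g) (restr_hom T v h)"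
    using restr_hom_Bij[of g v] restr_hom_Bij[of h v] assms
    by (simp add: Aut_def BijGroup_def subtree_def)
  also have "\<dots> = restr_hom T v (g \<otimes>\<^bsub>Aut T\<^esub> h)"
  proof
    fix x
    show "compose (descendants T v) (restr_hom T v g) (restr_hom T v h) x
        = restr_hom T v (g \<otimes>\<^bsub>Aut T\<^esub> h) x"
    proof (cases "x \<in> descendants T v")
      case True
      then have "x \<in> verts T" by (simp add: descendants_def)
      then show ?thesis
        using True descendants_fixed[OF assms(2,3,5)] assms(1,2)
        by (simp add: compose_def restr_hom_def Aut_mult_apply)
    qed (simp add: compose_def restr_hom_def)
  qed
  finally show ?thesis .
qed

section \<open>Stabilizers and rigid stabilizers as subgroups\<close>

lemma subgroup_tree_autsD: "subgroup K (Aut T) \<Longrightarrow> g \<in> K \<Longrightarrow> g \<in> tree_auts T"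
  using subgroup.subset[of K "Aut T"] by (auto simp: carrier_Aut)

lemma subgroup_Stab:
  assumes K: "subgroup K (Aut T)" and v: "v \<in> verts T"
  shows "subgroup (Stab K v) (Aut T)"
proof -
  have KA: "\<And>g. g \<in> K \<Longrightarrow> g \<in> tree_auts T" using subgroup_tree_autsD[OF K] .
  show ?thesis
  proof (rule A.subgroupI)
    show "Stab K v \<subseteq> carrier (Aut T)" using KA by (auto simp: Stab_def carrier_Aut)
    have "\<one>\<^bsub>Aut T\<^esub> \<in> Stab K v"
      using subgroup.one_closed[OF K] v by (simp add: Stab_def Aut_one_apply)
    then show "Stab K v \<noteq> {}" by blast
    fix g h assume "g \<in> Stab K v"
    then show "inv\<^bsub>Aut T\<^esub> g \<in> Stab K v"
      using subgroup.m_inv_closed[OF K, of g] KA v Aut_inv_fix[of g v] by (simp add: Stab_def)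
  next
    fix g h assume "g \<in> Stab K v" "h \<in> Stab K v"
    then show "g \<otimes>\<^bsub>Aut T\<^esub> h \<in> Stab K v"
      using subgroup.m_closed[OF K, of g h] KA v by (simp add: Stab_def Aut_mult_apply)
  qed
qed

lemma subgroup_Rist:
  assumes K: "subgroup K (Aut T)"
  shows "subgroup (Rist T K v) (Aut T)"
proof (rule A.subgroupI)
  show "Rist T K v \<subseteq> carrier (Aut T)"
    using subgroup_tree_autsD[OF K] by (auto simp: Rist_def carrier_Aut)
  have "\<one>\<^bsub>Aut T\<^esub> \<in> Rist T K v"
    using subgroup.one_closed[OF K] by (simp add: Rist_def Aut_one_apply)
  then show "Rist T K v \<noteq> {}" by blast
next
  fix g assume "g \<in> Rist T K v"
  then show "inv\<^bsub>Aut T\<^esub> g \<in> Rist T K v"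
    using subgroup.m_inv_closed[OF K, of g] subgroup_tree_autsD[OF K, of g] Aut_inv_fix[of g]
    by (simp add: Rist_def)
next
  fix g h assume "g \<in> Rist T K v" "h \<in> Rist T K v"
  then show "g \<otimes>\<^bsub>Aut T\<^esub> h \<in> Rist T K v"
    using subgroup.m_closed[OF K, of g h] subgroup_tree_autsD[OF K]
    by (simp add: Rist_def Aut_mult_apply)
qed

text \<open>Subtrees rooted at distinct vertices of one level are disjoint.\<close>

lemma Rist_trivial_on:
  assumes "g \<in> Rist T K x" "depth T x = depth T y" "x \<noteq> y" "z \<in> descendants T y"
  shows "g z = z"
  using assms descendant_unique[of z x y] descendants_subset[of T y] by (auto simp: Rist_def)

lemma Rist_fixes:
  assumes "g \<in> Rist T K x" "K \<subseteq> tree_auts T" "x \<in> verts T" "y \<in> verts T" "depth T y = depth T x"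
  shows "g y = y"
proof (cases "y = x")
  case True
  have g: "g \<in> tree_auts T" using assms by (auto simp: Rist_def)
  show ?thesis
  proof (rule ccontr)
    assume ne: "g y \<noteq> y"
    \<comment> \<open>A moved \<open>x\<close> would land outside its own subtree, where
      \<open>g\<close> is the identity; then \<open>g\<close> would send both \<open>y\<close> and
      \<open>g y\<close> to \<open>g y\<close>, against injectivity.\<close>
    then have "g y \<notin> descendants T x"
      using True descendant_same_depth[of "g y" x] depth_image[OF g assms(4)] by auto
    then have "g (g y) = g y" using assms(1,4) g by (simp add: Rist_def)
    with ne show False using tree_auts_inj[OF g, of "g y" y] g assms(4) by simp
  qed
next
  case False
  then show ?thesis
    using Rist_trivial_on[OF assms(1) _ _ self_descendant[OF assms(4)]] assms(5) by simp
qed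

section \<open>Sections of finite index\<close>

text \<open>Induction over the generated subgroup: below \<open>x\<close>, a generator supported at
  another vertex of the level acts as the identity, and one supported at \<open>x\<close> is its own
  witness \<open>s\<close>. Witnesses multiply because every factor preserves the set of descendants
  of \<open>x\<close>.\<close>

lemma Rist_level_local:
  assumes G: "subgroup G (Aut T)" and x: "x \<in> level T n" and r: "r \<in> Rist_level T G n"
  shows "r \<in> tree_auts T \<and> r x = x \<and> (\<exists>s\<in>Rist T G x. \<forall>y\<in>descendants T x. r y = s y)"
proof -
  have xv: "x \<in> verts T" using x by (simp add: level_def)
  have GA: "G \<subseteq> tree_auts T" using subgroup_tree_autsD[OF G] by blast
  have R: "subgroup (Rist T G x) (Aut T)" by (rule subgroup_Rist[OF G])
  have base: "h \<in> tree_auts T \<and> h x = x \<and> (\<exists>s\<in>Rist T G x. \<forall>y\<in>descendants T x. h y = s y)"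
    if h: "h \<in> (\<Union>v\<in>level T n. Rist T G v)" for h
  proof -
    obtain v where v: "v \<in> level T n" "h \<in> Rist T G v" using h by blast
    have "h \<in> tree_auts T" using v GA by (auto simp: Rist_def)
    moreover have "h x = x"
      using Rist_fixes[OF v(2) GA _ xv] v(1) x by (simp add: level_def)
    moreover have "\<exists>s\<in>Rist T G x. \<forall>y\<in>descendants T x. h y = s y"
    proof (cases "v = x")
      case False
      then have "\<forall>y\<in>descendants T x. h y = \<one>\<^bsub>Aut T\<^esub> y"
        using Rist_trivial_on[OF v(2), of x] v(1) x descendants_subset[of T x]
        by (auto simp: level_def Aut_one_apply)
      then show ?thesis using subgroup.one_closed[OF R] by blast
    qed (use v in blast)
    ultimately show ?thesis by blast
  qed
  show ?thesis using r unfolding Rist_level_def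
  proof (induction rule: generate.induct)
    case one
    have "\<one>\<^bsub>Aut T\<^esub> \<in> tree_auts T" using A.one_closed by (simp add: carrier_Aut)
    then show ?case using subgroup.one_closed[OF R] xv by (auto simp: Aut_one_apply)
  next
    case (incl h)
    then show ?case by (rule base)
  next
    case (inv h)
    \<comment> \<open>The generating set is closed under inverses, so this is again a
      generator.\<close>
    then have "inv\<^bsub>Aut T\<^esub> h \<in> (\<Union>v\<in>level T n. Rist T G v)"
      using subgroup.m_inv_closed[OF subgroup_Rist[OF G]] by blast
    then show ?case by (rule base)
  next
    case (eng g h)
    obtain s t where st: "s \<in> Rist T G x" "\<forall>y\<in>descendants T x. g y = s y"
      "t \<in> Rist T G x" "\<forall>y\<in>descendants T x. h y = t y" using eng.IH by blast
    have stA: "s \<in> tree_auts T" "t \<in> tree_auts T" using st GA by (auto simp: Rist_def)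
    have "(g \<otimes>\<^bsub>Aut T\<^esub> h) y = (s \<otimes>\<^bsub>Aut T\<^esub> t) y" if y: "y \<in> descendants T x" for y
    proof -
      have "y \<in> verts T" using y by (rule descendants_verts)
      moreover have "h y \<in> descendants T x" using descendants_fixed y xv eng.IH by blast
      ultimately show ?thesis using eng.IH st stA y by (simp add: Aut_mult_apply)
    qed
    moreover have "s \<otimes>\<^bsub>Aut T\<^esub> t \<in> Rist T G x" using subgroup.m_closed[OF R] st by blast
    ultimately show ?case using eng.IH xv by (auto simp: Aut_mult_apply)
  qed
qed

text \<open>
  \<open>Rist_level T G n\<close> and \<open>Rist T G x\<close> have the same section at \<open>x\<close>, so finite index of the
  former makes \<open>restr_hom T x ` Rist T G x\<close> of finite index in the section of \<open>G\<close>, and its trace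
  on the section of \<open>K\<close> of finite index there.
\<close>

lemma finite_section:
  assumes G: "subgroup G (Aut T)" and K: "subgroup K (Aut T)" "K \<subseteq> Stab G x"
    and x: "x \<in> level T n"
    and fin: "has_finite_index (Rist_level T G n) ((Aut T)\<lparr>carrier := G\<rparr>)"
    and F: "finite {g \<in> Rist T G x. restr_hom T x g \<in> restr_hom T x ` K}" (is "finite ?F")
  shows "finite (restr_hom T x ` K)"
proof -
  let ?R = "Rist_level T G n"
  let ?p = "\<lambda>k. ?R #>\<^bsub>Aut T\<^esub> k"
  have xv: "x \<in> verts T" using x by (simp add: level_def)
  have KA: "k \<in> tree_auts T \<and> k x = x" if "k \<in> K" for k
    using that K subgroup_tree_autsD by (auto simp: Stab_def)
  have "?p ` K \<subseteq> rcosets\<^bsub>(Aut T)\<lparr>carrier := G\<rparr>\<^esub> ?R"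
    using K(2) by (auto simp: RCOSETS_def r_coset_def Stab_def)
  then have finP: "finite (?p ` K)" using fin unfolding has_finite_index_def by (rule finite_subset)
  \<comment> \<open>\<open>c\<close> picks in \<open>K\<close> a representative of each coset met by
    \<open>K\<close>. Every section of \<open>K\<close> will come from a pair of an element of
    \<open>?F\<close> and such a coset.\<close>
  define c where "c = inv_into K ?p"
  have "restr_hom T x ` K \<subseteq> (\<lambda>(f, C). restr_hom T x (f \<otimes>\<^bsub>Aut T\<^esub> c C)) ` (?F \<times> ?p ` K)"
  proof
    fix z assume "z \<in> restr_hom T x ` K"
    then obtain k where k: "k \<in> K" "z = restr_hom T x k" by blast
    define k' where "k' = c (?p k)"
    have k': "k' \<in> K" "?p k' = ?p k"
      using inv_into_into[of "?p k" ?p K] f_inv_into_f[of "?p k" ?p K] k(1)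
      unfolding k'_def c_def by blast+
    have "\<one>\<^bsub>Aut T\<^esub> \<in> ?R" by (simp add: Rist_level_def generate.one)
    then have "\<one>\<^bsub>Aut T\<^esub> \<otimes>\<^bsub>Aut T\<^esub> k \<in> ?p k" unfolding r_coset_def by blast
    then have "k \<in> ?p k'" using KA[OF k(1)] k'(2) by (simp add: carrier_Aut)
    then obtain r where r: "r \<in> ?R" "k = r \<otimes>\<^bsub>Aut T\<^esub> k'" by (auto simp: r_coset_def)
    obtain s where s: "r \<in> tree_auts T" "r x = x" "s \<in> Rist T G x"
      "\<forall>y\<in>descendants T x. r y = s y"
      using Rist_level_local[OF G x r(1)] by blast
    have sA: "s \<in> tree_auts T" using s(3) subgroup_tree_autsD[OF G] by (auto simp: Rist_def)
    have "r = k \<otimes>\<^bsub>Aut T\<^esub> inv\<^bsub>Aut T\<^esub> k'"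
      using r(2) s(1) KA[OF k(1)] KA[OF k'(1)] A.inv_solve_right[of r k k']
      by (simp add: carrier_Aut)
    \<comment> \<open>As a quotient of two elements of \<open>K\<close>, \<open>r\<close> lies in
      \<open>K\<close>; its local replacement \<open>s\<close> has the same restriction, which puts
      \<open>s\<close> into \<open>?F\<close>.\<close>
    then have "r \<in> K"
      using k(1) k'(1) K(1) by (simp add: subgroup.m_closed subgroup.m_inv_closed)
    moreover have rs: "restr_hom T x s = restr_hom T x r" using s(4) by (simp add: restr_hom_eq_iff)
    ultimately have "s \<in> ?F" using s(3) by simp
    moreover have "z = restr_hom T x (s \<otimes>\<^bsub>Aut T\<^esub> k')"
    proof -
      have "k y = (s \<otimes>\<^bsub>Aut T\<^esub> k') y" if y: "y \<in> descendants T x" for y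
      proof -
        have "y \<in> verts T" using y by (rule descendants_verts)
        moreover have "k' y \<in> descendants T x" using descendants_fixed KA[OF k'(1)] xv y by blast
        ultimately show ?thesis using s sA KA[OF k'(1)] r(2) by (simp add: Aut_mult_apply)
      qed
      then show ?thesis using k(2) by (simp add: restr_hom_eq_iff)
    qed
    ultimately show "z \<in> (\<lambda>(f, C). restr_hom T x (f \<otimes>\<^bsub>Aut T\<^esub> c C)) ` (?F \<times> ?p ` K)"
      unfolding k'_def using k(1) by (intro image_eqI[where x = "(s, ?p k)"]) simp_all
  qed
  moreover have "finite (?F \<times> ?p ` K)" using F finP by blast
  ultimately show ?thesis by (meson finite_imageI finite_subset)
qed

text \<open>Two elements of \<open>Stab G u\<close> in one right coset of \<open>M\<close> differ by
  an element of \<open>M\<close> fixing \<open>u\<close>, which looks below \<open>u\<close> like an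
  element of \<open>Stab W u\<close>. Their restrictions therefore lie in one coset of the section
  of \<open>W\<close>, which thus has at most as many cosets as \<open>M\<close>.\<close>

lemma has_finite_index_section:
  assumes G: "subgroup G (Aut T)" and W: "subgroup W (Aut T)" and M: "subgroup M (Aut T)"
    and u: "u \<in> verts T"
    and fin: "has_finite_index M ((Aut T)\<lparr>carrier := G\<rparr>)"
    and agree: "\<And>g. g \<in> M \<Longrightarrow> g u = u \<Longrightarrow> \<exists>h\<in>Stab W u. \<forall>y\<in>descendants T u. g y = h y"
  shows "has_finite_index (restr_hom T u ` Stab W u)
           ((Aut (subtree T u))\<lparr>carrier := restr_hom T u ` Stab G u\<rparr>)"
proof -
  let ?p = "\<lambda>g. M #>\<^bsub>Aut T\<^esub> g"
  \<comment> \<open>The coset of the section of \<open>W\<close> through the restriction of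
    \<open>g\<close>, with the product taken in \<open>Aut T\<close>; \<open>restr_hom_mult\<close>
    identifies it with the true coset at the end.\<close>
  let ?f = "\<lambda>g. (\<lambda>k. restr_hom T u (k \<otimes>\<^bsub>Aut T\<^esub> g)) ` Stab W u"
  have GA: "g \<in> tree_auts T \<and> g u = u" if "g \<in> Stab G u" for g
    using that subgroup_tree_autsD[OF G] by (auto simp: Stab_def)
  have WA: "g \<in> tree_auts T \<and> g u = u" if "g \<in> Stab W u" for g
    using that subgroup_tree_autsD[OF W] by (auto simp: Stab_def)
  have SW: "subgroup (Stab W u) (Aut T)" by (rule subgroup_Stab[OF W u])
  have sub: "?f g \<subseteq> ?f g'"
    if g: "g \<in> Stab G u" and g': "g' \<in> Stab G u" and eq: "?p g = ?p g'" for g g'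
  proof
    have "g \<in> ?p g" using A.rcos_self[OF _ M] GA[OF g] by (simp add: carrier_Aut)
    then obtain m where m: "m \<in> M" "g = m \<otimes>\<^bsub>Aut T\<^esub> g'" unfolding eq by (auto simp: r_coset_def)
    have mA: "m \<in> tree_auts T" using m(1) subgroup_tree_autsD[OF M] by blast
    have "m u = u" using m(2) mA GA[OF g] GA[OF g'] Aut_mult_apply[of m T g' u] u by simp
    from agree[OF m(1) this] obtain h where
      h: "h \<in> Stab W u" "\<forall>y\<in>descendants T u. m y = h y" by blast
    fix z assume "z \<in> ?f g"
    then obtain k where k: "k \<in> Stab W u" "z = restr_hom T u (k \<otimes>\<^bsub>Aut T\<^esub> g)" by blast
    have "(k \<otimes>\<^bsub>Aut T\<^esub> g) y = ((k \<otimes>\<^bsub>Aut T\<^esub> h) \<otimes>\<^bsub>Aut T\<^esub> g') y"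
      if y: "y \<in> descendants T u" for y
    proof -
      have "g' y \<in> descendants T u" using descendants_fixed GA[OF g'] u y by blast
      moreover have "y \<in> verts T" "g' y \<in> verts T"
        using y calculation by (simp_all add: descendants_verts)
      ultimately show ?thesis
        using m(2) mA h WA[OF k(1)] WA[OF h(1)] GA[OF g] GA[OF g'] by (simp add: Aut_mult_apply)
    qed
    then have "z = restr_hom T u ((k \<otimes>\<^bsub>Aut T\<^esub> h) \<otimes>\<^bsub>Aut T\<^esub> g')"
      using k(2) by (simp add: restr_hom_eq_iff)
    then show "z \<in> ?f g'" using subgroup.m_closed[OF SW k(1) h(1)] by blast
  qed
  have "?p ` Stab G u \<subseteq> rcosets\<^bsub>(Aut T)\<lparr>carrier := G\<rparr>\<^esub> M"
    by (auto simp: RCOSETS_def r_coset_def Stab_def)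
  then have finP: "finite (?p ` Stab G u)"
    using fin unfolding has_finite_index_def by (rule finite_subset)
  \<comment> \<open>By \<open>sub\<close>, used in both directions, \<open>?f\<close> depends only
    on the coset \<open>?p g\<close>, so it has finitely many values.\<close>
  have "?f ` Stab G u \<subseteq> (\<lambda>C. ?f (inv_into (Stab G u) ?p C)) ` ?p ` Stab G u"
  proof
    fix z assume "z \<in> ?f ` Stab G u"
    then obtain g where g: "g \<in> Stab G u" "z = ?f g" by blast
    define g' where "g' = inv_into (Stab G u) ?p (?p g)"
    have g': "g' \<in> Stab G u" "?p g' = ?p g"
      using inv_into_into[of "?p g" ?p "Stab G u"] f_inv_into_f[of "?p g" ?p "Stab G u"] g(1)
      unfolding g'_def by blast+
    have "z = ?f g'" using sub[OF g(1) g'(1)] sub[OF g'(1) g(1)] g'(2) g(2) by simp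
    then show "z \<in> (\<lambda>C. ?f (inv_into (Stab G u) ?p C)) ` ?p ` Stab G u"
      unfolding g'_def using g(1) by blast
  qed
  then have finf: "finite (?f ` Stab G u)" using finP by (meson finite_imageI finite_subset)
  have "rcosets\<^bsub>(Aut (subtree T u))\<lparr>carrier := restr_hom T u ` Stab G u\<rparr>\<^esub> (restr_hom T u ` Stab W u)
      \<subseteq> ?f ` Stab G u"
  proof
    fix C
    assume "C \<in> rcosets\<^bsub>(Aut (subtree T u))\<lparr>carrier := restr_hom T u ` Stab G u\<rparr>\<^esub>
                  (restr_hom T u ` Stab W u)"
    then obtain g where g: "g \<in> Stab G u"
      and C: "C = (\<lambda>k. restr_hom T u k \<otimes>\<^bsub>Aut (subtree T u)\<^esub> restr_hom T u g) ` Stab W u"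
      by (auto simp: RCOSETS_def r_coset_def)
    have "C = ?f g"
      unfolding C by (rule image_cong) (use WA GA[OF g] u in \<open>auto simp: restr_hom_mult\<close>)
    then show "C \<in> ?f ` Stab G u" using g by blast
  qed
  then show ?thesis unfolding has_finite_index_def using finf by (rule finite_subset)
qed

section \<open>Weakly maximal subgroups\<close>

text \<open>The elements of \<open>G\<close> with the local property \<open>agree\<close> form a
  group \<open>M\<close> containing \<open>W\<close>. At \<open>u\<close> it has the same section as
  \<open>W\<close>, so finite index of \<open>M\<close> would contradict \<open>inf\<close>;
  maximality of \<open>W\<close> then forces \<open>M = W\<close>.\<close>

lemma weakly_maximal_local:
  assumes G: "subgroup G (Aut T)" and wm: "weakly_maximal W ((Aut T)\<lparr>carrier := G\<rparr>)"
    and u: "u \<in> verts T"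
    and inf: "\<not> has_finite_index (restr_hom T u ` Stab W u)
               ((Aut (subtree T u))\<lparr>carrier := restr_hom T u ` Stab G u\<rparr>)"
    and g: "g \<in> G"
    and agree: "\<forall>w\<in>W. \<exists>h\<in>W. \<forall>y\<in>descendants T (w u). g y = h y"
      "\<forall>w\<in>W. \<exists>h\<in>W. \<forall>y\<in>descendants T (w u). (inv\<^bsub>Aut T\<^esub> g) y = h y"
  shows "g \<in> W"
proof -
  \<comment> \<open>The element \<open>h\<close> may depend on the orbit vertex \<open>w u\<close>.
    Asking \<open>Q\<close> of the inverse as well, in \<open>M\<close>, makes closure under
    inverses immediate.\<close>
  define Q where "Q g \<longleftrightarrow> (\<forall>w\<in>W. \<exists>h\<in>W. \<forall>y\<in>descendants T (w u). g y = h y)" for g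
  define M where "M = {g \<in> G. Q g \<and> Q (inv\<^bsub>Aut T\<^esub> g)}"
  have GA: "\<And>g. g \<in> G \<Longrightarrow> g \<in> tree_auts T" using subgroup_tree_autsD[OF G] .
  have WG: "subgroup W ((Aut T)\<lparr>carrier := G\<rparr>)" using wm by (simp add: weakly_maximal_def)
  have W: "subgroup W (Aut T)" by (rule A.incl_subgroup[OF G WG])
  have WsG: "W \<subseteq> G" using subgroup.subset[OF WG] by simp
  have QW: "Q h" if "h \<in> W" for h using that by (auto simp: Q_def)
  have Qmult: "Q (a \<otimes>\<^bsub>Aut T\<^esub> b)" if ab: "a \<in> G" "b \<in> G" "Q a" "Q b" for a b
    unfolding Q_def
  proof
    fix w assume w: "w \<in> W"
    have wu: "w u \<in> verts T" using w WsG GA u by auto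
    \<comment> \<open>Below \<open>w u\<close>, \<open>b\<close> acts like \<open>h\<close> and so
      lands below \<open>h (w u)\<close>, again a vertex of the orbit of \<open>u\<close>; there
      \<open>a\<close> acts like some \<open>k\<close>, and the product acts like that of
      \<open>k\<close> and \<open>h\<close>.\<close>
    obtain h where h: "h \<in> W" "\<forall>y\<in>descendants T (w u). b y = h y"
      using ab(4) w unfolding Q_def by blast
    have hA: "h \<in> tree_auts T" using h WsG GA by blast
    have hw: "h \<otimes>\<^bsub>Aut T\<^esub> w \<in> W" "(h \<otimes>\<^bsub>Aut T\<^esub> w) u = h (w u)"
      using subgroup.m_closed[OF W h(1) w] w hA WsG GA u by (auto simp: Aut_mult_apply)
    obtain k where k: "k \<in> W" "\<forall>y\<in>descendants T (h (w u)). a y = k y"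
      using ab(3) hw unfolding Q_def by metis
    have kA: "k \<in> tree_auts T" using k WsG GA by blast
    have "(a \<otimes>\<^bsub>Aut T\<^esub> b) y = (k \<otimes>\<^bsub>Aut T\<^esub> h) y" if y: "y \<in> descendants T (w u)" for y
    proof -
      have "y \<in> verts T" using y by (rule descendants_verts)
      moreover have "h y \<in> descendants T (h (w u))"
        using descendants_image[OF hA wu descendants_verts[OF y]] y by simp
      ultimately show ?thesis
        using h(2) k(2) y GA[OF ab(1)] GA[OF ab(2)] hA kA by (simp add: Aut_mult_apply)
    qed
    then show "\<exists>h\<in>W. \<forall>y\<in>descendants T (w u). (a \<otimes>\<^bsub>Aut T\<^esub> b) y = h y"
      using subgroup.m_closed[OF W k(1) h(1)] by blast
  qed
  have WM: "W \<subseteq> M"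
    using WsG QW subgroup.m_inv_closed[OF W] by (auto simp: M_def)
  have M: "subgroup M (Aut T)"
  proof (rule A.subgroupI)
    show "M \<subseteq> carrier (Aut T)" using GA by (auto simp: M_def carrier_Aut)
    show "M \<noteq> {}" using WM subgroup.one_closed[OF W] by blast
  next
    fix a assume "a \<in> M"
    then show "inv\<^bsub>Aut T\<^esub> a \<in> M"
      using subgroup.m_inv_closed[OF G, of a] GA[of a] by (simp add: M_def carrier_Aut)
  next
    fix a b assume a: "a \<in> M" and b: "b \<in> M"
    then have ab: "a \<in> G" "b \<in> G" "Q a" "Q b" "Q (inv\<^bsub>Aut T\<^esub> a)" "Q (inv\<^bsub>Aut T\<^esub> b)"
      by (simp_all add: M_def)
    have "inv\<^bsub>Aut T\<^esub> (a \<otimes>\<^bsub>Aut T\<^esub> b) = inv\<^bsub>Aut T\<^esub> b \<otimes>\<^bsub>Aut T\<^esub> inv\<^bsub>Aut T\<^esub> a"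
      using GA ab by (intro A.inv_mult_group) (simp_all add: carrier_Aut)
    moreover have "Q (inv\<^bsub>Aut T\<^esub> b \<otimes>\<^bsub>Aut T\<^esub> inv\<^bsub>Aut T\<^esub> a)"
      using ab by (intro Qmult) (simp_all add: subgroup.m_inv_closed[OF G])
    ultimately show "a \<otimes>\<^bsub>Aut T\<^esub> b \<in> M"
      using Qmult[OF ab(1-4)] subgroup.m_closed[OF G ab(1,2)] by (simp add: M_def)
  qed
  have "subgroup M ((Aut T)\<lparr>carrier := G\<rparr>)"
    by (rule A.subgroup_incl[OF M G]) (auto simp: M_def)
  moreover have "\<not> has_finite_index M ((Aut T)\<lparr>carrier := G\<rparr>)"
  proof
    assume "has_finite_index M ((Aut T)\<lparr>carrier := G\<rparr>)"
    then have "has_finite_index (restr_hom T u ` Stab W u)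
               ((Aut (subtree T u))\<lparr>carrier := restr_hom T u ` Stab G u\<rparr>)"
    proof (rule has_finite_index_section[OF G W M u])
      fix a assume a: "a \<in> M" "a u = u"
      \<comment> \<open>The orbit vertex given by the identity is \<open>u\<close> itself; the
        \<open>h\<close> found there fixes \<open>u\<close> because \<open>a\<close> does and
        \<open>u\<close> counts among its own descendants.\<close>
      have "\<one>\<^bsub>Aut T\<^esub> \<in> W" using subgroup.one_closed[OF W] .
      with a(1) obtain h where h: "h \<in> W" "\<forall>y\<in>descendants T (\<one>\<^bsub>Aut T\<^esub> u). a y = h y"
        unfolding M_def Q_def by blast
      then show "\<exists>h\<in>Stab W u. \<forall>y\<in>descendants T u. a y = h y"
        using a(2) u self_descendant[OF u] by (auto simp: Stab_def Aut_one_apply)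
    qed
    with inf show False ..
  qed
  ultimately have "M = W" using wm WM unfolding weakly_maximal_def by blast
  moreover have "g \<in> M" using g agree by (simp add: M_def Q_def)
  ultimately show ?thesis by simp
qed

text \<open>Below every orbit vertex other than \<open>x\<close> the element \<open>g\<close> acts
  as the identity, so agreement with \<open>W\<close> is in question only at \<open>x\<close>. If
  \<open>x\<close> lies outside the orbit of \<open>u\<close>, \<open>agree\<close> is
  vacuous.\<close>

lemma Rist_in_weakly_maximal:
  assumes G: "subgroup G (Aut T)" and wm: "weakly_maximal W ((Aut T)\<lparr>carrier := G\<rparr>)"
    and u: "u \<in> level T n" and x: "x \<in> level T n"
    and inf: "\<not> has_finite_index (restr_hom T u ` Stab W u)
               ((Aut (subtree T u))\<lparr>carrier := restr_hom T u ` Stab G u\<rparr>)"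
    and g: "g \<in> Rist T G x"
    and agree: "\<And>w. \<lbrakk>w \<in> W; w u = x\<rbrakk> \<Longrightarrow> \<exists>h\<in>W. \<forall>y\<in>descendants T x. g y = h y"
  shows "g \<in> W"
proof -
  have GA: "G \<subseteq> tree_auts T" using subgroup_tree_autsD[OF G] by blast
  have WG: "subgroup W ((Aut T)\<lparr>carrier := G\<rparr>)" using wm by (simp add: weakly_maximal_def)
  have W: "subgroup W (Aut T)" by (rule A.incl_subgroup[OF G WG])
  have WA: "W \<subseteq> tree_auts T" using subgroup_tree_autsD[OF W] by blast
  have xv: "x \<in> verts T" and uv: "u \<in> verts T" using u x by (auto simp: level_def)
  have gG: "g \<in> G" using g by (simp add: Rist_def)
  have gA: "g \<in> tree_auts T" using gG GA by blast
  have gi: "inv\<^bsub>Aut T\<^esub> g \<in> Rist T G x" by (rule subgroup.m_inv_closed[OF subgroup_Rist[OF G] g])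
  have gx: "(inv\<^bsub>Aut T\<^esub> g) x = x" by (rule Rist_fixes[OF gi GA xv xv refl])
  have agree': "\<exists>h\<in>W. \<forall>y\<in>descendants T x. (inv\<^bsub>Aut T\<^esub> g) y = h y"
    if w: "w \<in> W" "w u = x" for w
  proof -
    obtain h where h: "h \<in> W" "\<forall>y\<in>descendants T x. g y = h y" using agree[OF w] by blast
    have "(inv\<^bsub>Aut T\<^esub> g) y = (inv\<^bsub>Aut T\<^esub> h) y" if y: "y \<in> descendants T x" for y
    proof -
      \<comment> \<open>The inverses of \<open>g\<close> and \<open>h\<close> are compared at
        \<open>y\<close> through \<open>?z\<close>, which \<open>g\<close> and hence
        \<open>h\<close> send to \<open>y\<close>.\<close>
      let ?z = "(inv\<^bsub>Aut T\<^esub> g) y"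
      have z: "?z \<in> descendants T x"
        by (rule descendants_fixed[OF Aut_inv_closed[OF gA] xv gx y])
      then have "h ?z = g ?z" using h(2) by simp
      also have "\<dots> = y" by (rule Aut_inv_apply(2)[OF gA descendants_verts[OF y]])
      finally have "(inv\<^bsub>Aut T\<^esub> h) (h ?z) = (inv\<^bsub>Aut T\<^esub> h) y" by simp
      moreover have "(inv\<^bsub>Aut T\<^esub> h) (h ?z) = ?z"
        using h(1) WA by (intro Aut_inv_apply(1)[OF _ descendants_verts[OF z]]) blast
      ultimately show ?thesis by simp
    qed
    then show ?thesis using subgroup.m_inv_closed[OF W h(1)] by blast
  qed
  have away: "\<forall>y\<in>descendants T (w u). k y = \<one>\<^bsub>Aut T\<^esub> y"
    if "w \<in> W" "w u \<noteq> x" "k \<in> Rist T G x" for w k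
  proof -
    have "w u \<in> level T n" using level_image u that WA by blast
    then show ?thesis
      using Rist_trivial_on[OF that(3), of "w u"] that(2) x descendants_subset[of T "w u"]
      by (auto simp: level_def Aut_one_apply)
  qed
  show ?thesis
  proof (rule weakly_maximal_local[OF G wm uv inf gG]; intro ballI)
    fix w assume w: "w \<in> W"
    show "\<exists>h\<in>W. \<forall>y\<in>descendants T (w u). g y = h y"
      using agree[OF w] away[OF w _ g] subgroup.one_closed[OF W] by (cases "w u = x") auto
    show "\<exists>h\<in>W. \<forall>y\<in>descendants T (w u). (inv\<^bsub>Aut T\<^esub> g) y = h y"
      using agree'[OF w] away[OF w _ gi] subgroup.one_closed[OF W] by (cases "w u = x") auto
  qed
qed

end

section \<open>Finite sections against transitivity on levels\<close>

text \<open>An element taking one descendant of \<open>v\<close> to another of the same level fixes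
  \<open>v\<close>, so the image of \<open>x\<close> under it is read off from its section at
  \<open>v\<close>. With \<open>N\<close> sections at most \<open>N\<close> images occur, whereas
  \<open>v\<close> has at least \<open>N + 1\<close> descendants \<open>N\<close> levels further
  down.\<close>

lemma (in spherically_regular_tree) finite_section_not_transitive:
  assumes v: "v \<in> verts T" and K: "K \<subseteq> tree_auts T" and fin: "finite (restr_hom T v ` Stab K v)"
  shows "\<exists>m. \<exists>x\<in>descendants T v \<inter> level T m. \<exists>y\<in>descendants T v \<inter> level T m. \<forall>k\<in>K. k x \<noteq> y"
proof -
  define N where "N = card (restr_hom T v ` Stab K v)"
  obtain S where S: "S \<subseteq> descendants T v \<inter> level T (depth T v + N)" "finite S" "card S = Suc N"
    using many_descendants[OF v] by blast
  then obtain x where x: "x \<in> S" by fastforce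
  have xd: "x \<in> descendants T v" and xv: "x \<in> verts T"
    using x S(1) by (auto dest: descendants_verts)
  show ?thesis
  proof (rule ccontr)
    assume "\<not> ?thesis"
    then have trans: "\<exists>k\<in>K. k x = y" if "y \<in> S" for y using that x S(1) by blast
    have "S \<subseteq> (\<lambda>p. p x) ` restr_hom T v ` Stab K v"
    proof
      fix y assume y: "y \<in> S"
      obtain k where k: "k \<in> K" "k x = y" using trans[OF y] by blast
      have kA: "k \<in> tree_auts T" using k K by blast
      have "y \<in> descendants T (k v)" using descendants_image[OF kA v xv] xd k(2) by simp
      moreover have "y \<in> descendants T v" using y S(1) by blast
      \<comment> \<open>\<open>v\<close> and \<open>k v\<close> are ancestors of \<open>y\<close> of
        the same depth.\<close>
      ultimately have "k v = v" by (rule descendant_unique) (simp add: depth_image[OF kA v])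
      then have "k \<in> Stab K v" using k by (simp add: Stab_def)
      moreover have "restr_hom T v k x = y" using k(2) xd by (simp add: restr_hom_def)
      ultimately show "y \<in> (\<lambda>p. p x) ` restr_hom T v ` Stab K v" by blast
    qed
    then have "card S \<le> N" unfolding N_def by (rule surj_card_le[OF fin])
    with S(3) show False by simp
  qed
qed

text \<open>A finite \<open>Rist T G x\<close> would make the whole section of \<open>G\<close> at
  \<open>x\<close> finite, and \<open>G\<close> could not be transitive on every level.\<close>

lemma (in spherically_regular_tree) infinite_Rist:
  assumes br: "branch T G" and x: "x \<in> verts T"
  shows "infinite (Rist T G x)"
proof
  assume fin: "finite (Rist T G x)"
  have G: "subgroup G (Aut T)" using br by (simp add: branch_def)
  have xl: "x \<in> level T (depth T x)" using x by (simp add: level_def)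
  have "finite (restr_hom T x ` Stab G x)"
    by (rule finite_section[OF G subgroup_Stab[OF G x] subset_refl xl])
       (use br fin in \<open>auto simp: branch_def\<close>)
  then obtain m y z where "y \<in> level T m" "z \<in> level T m" "\<forall>g\<in>G. g y \<noteq> z"
    using finite_section_not_transitive[OF x] subgroup_tree_autsD[OF G] by (metis IntD2 subsetI)
  then show False using br unfolding branch_def by blast
qed

section \<open>The dichotomy for weakly maximal subgroups\<close>

theorem proposition1p12:
  fixes T :: "'v rooted_graph" and G W :: "('v \<Rightarrow> 'v) set"
  assumes "spherically_regular_tree T"
    and "branch T G"
    and "weakly_maximal W ((Aut T)\<lparr>carrier := G\<rparr>)"
  shows "(\<forall>v\<in>verts T. infinite (Rist T W v)) \<or>
         (\<exists>n. \<forall>v\<in>level T n.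
            has_finite_index (restr_hom T v ` Stab W v)
              ((Aut (subtree T v))\<lparr>carrier := restr_hom T v ` Stab G v\<rparr>))"
proof (rule ccontr)
  assume neg: "\<not> ?thesis"
  interpret spherically_regular_tree T by fact
  have G: "subgroup G (Aut T)" using assms(2) by (simp add: branch_def)
  have WG: "subgroup W ((Aut T)\<lparr>carrier := G\<rparr>)" using assms(3) by (simp add: weakly_maximal_def)
  have W: "subgroup W (Aut T)" by (rule group.incl_subgroup[OF group_Aut G WG])
  have WsG: "W \<subseteq> G" using subgroup.subset[OF WG] by simp
  have WA: "W \<subseteq> tree_auts T" using subgroup_tree_autsD[OF W] by blast
  obtain v where v: "v \<in> verts T" "finite (Rist T W v)" using neg by blast
  \<comment> \<open>For \<open>x\<close> below \<open>v\<close>, \<open>Rist T W x\<close> is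
    contained in \<open>Rist T W v\<close>.\<close>
  have fin_Rist: "finite (Rist T W x)" if "x \<in> descendants T v" for x
    by (rule finite_subset[OF _ v(2)]) (use that descendants_trans in \<open>auto simp: Rist_def\<close>)
  have key: "\<exists>u\<in>level T m. \<forall>x\<in>descendants T v \<inter> level T m.
      (\<exists>w\<in>W. w u = x) \<and> finite (restr_hom T x ` Stab W x)" for m
  proof -
    \<comment> \<open>Failure of the second alternative at level \<open>m\<close> supplies
      \<open>u\<close>, which need not lie below \<open>v\<close>.\<close>
    obtain u where u: "u \<in> level T m"
      and inf: "\<not> has_finite_index (restr_hom T u ` Stab W u)
               ((Aut (subtree T u))\<lparr>carrier := restr_hom T u ` Stab G u\<rparr>)"
      using neg by blast
    have "(\<exists>w\<in>W. w u = x) \<and> finite (restr_hom T x ` Stab W x)"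
      if x: "x \<in> descendants T v" "x \<in> level T m" for x
    proof
      have xv: "x \<in> verts T" using x(2) by (simp add: level_def)
      show "\<exists>w\<in>W. w u = x"
      proof (rule ccontr)
        assume "\<not> ?thesis"
        then have "Rist T G x \<subseteq> W"
          using Rist_in_weakly_maximal[OF G assms(3) u x(2) inf] by blast
        then have "Rist T G x \<subseteq> Rist T W x" by (auto simp: Rist_def)
        then show False
          using infinite_Rist[OF assms(2) xv] fin_Rist[OF x(1)] finite_subset by blast
      qed
      show "finite (restr_hom T x ` Stab W x)"
      proof (rule finite_section[OF G subgroup_Stab[OF W xv] _ x(2)])
        show "Stab W x \<subseteq> Stab G x" using WsG by (auto simp: Stab_def)
        show "has_finite_index (Rist_level T G m) ((Aut T)\<lparr>carrier := G\<rparr>)"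
          using assms(2) by (simp add: branch_def)
        \<comment> \<open>An element of \<open>Rist T G x\<close> whose section is one of
          \<open>W\<close> agrees below \<open>x\<close> with an element of \<open>W\<close>, and so
          lies in \<open>W\<close>.\<close>
        have "{g \<in> Rist T G x. restr_hom T x g \<in> restr_hom T x ` Stab W x} \<subseteq> Rist T W x"
        proof
          fix g assume g: "g \<in> {g \<in> Rist T G x. restr_hom T x g \<in> restr_hom T x ` Stab W x}"
          then have "\<exists>h\<in>W. \<forall>y\<in>descendants T x. g y = h y"
            by (auto simp: restr_hom_eq_iff Stab_def)
          then have "g \<in> W"
            using Rist_in_weakly_maximal[OF G assms(3) u x(2) inf, of g] g by blast
          then show "g \<in> Rist T W x" using g by (simp add: Rist_def)
        qed
        then show "finite {g \<in> Rist T G x. restr_hom T x g \<in> restr_hom T x ` Stab W x}"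
          using fin_Rist[OF x(1)] by (rule finite_subset)
      qed
    qed
    with u show ?thesis by blast
  qed
  \<comment> \<open>This is \<open>key\<close> at the level of \<open>v\<close>, applied to the
    vertex \<open>v\<close> itself.\<close>
  have "finite (restr_hom T v ` Stab W v)"
    using key[of "depth T v"] self_descendant[OF v(1)] v(1) by (auto simp: level_def)
  then obtain m x y where xy: "x \<in> descendants T v \<inter> level T m" "y \<in> descendants T v \<inter> level T m"
    and no: "\<forall>w\<in>W. w x \<noteq> y"
    using finite_section_not_transitive[OF v(1) WA] by blast
  \<comment> \<open>At level \<open>m\<close> both vertices lie in the \<open>W\<close>-orbit of the
    same \<open>u\<close>, so \<open>?w\<close> carries \<open>x\<close> to \<open>y\<close> by way
    of \<open>u\<close>.\<close>
  obtain u a b where u: "u \<in> level T m" and ab: "a \<in> W" "a u = x" "b \<in> W" "b u = y"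
    using key[of m] xy by meson
  let ?w = "b \<otimes>\<^bsub>Aut T\<^esub> inv\<^bsub>Aut T\<^esub> a"
  have "?w \<in> W" using ab subgroup.m_closed[OF W] subgroup.m_inv_closed[OF W] by blast
  moreover have "?w x = y"
  proof -
    have "a \<in> tree_auts T" "b \<in> tree_auts T" "x \<in> verts T" "u \<in> verts T"
      using ab WA u xy(1) by (auto simp: level_def)
    then show ?thesis using ab Aut_inv_apply(1)[of a u] by (simp add: Aut_mult_apply)
  qed
  ultimately show False using no by blast
qed

end
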